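(* If $T$ is a line trigraph, then every realization of $T$ is the line graph of a bipartite graph, and every semirealization of $T$ is a line trigraph.
   Context: A trigraph $T$ consists of a finite vertex set $V(T)$ and a map $\theta:\binom{V(T)}{2}\to\{-1,0,1\}$. Distinct $u,v$ are strongly adjacent if $\theta(uv)=1$, strongly antiadjacent if $\theta(uv)=-1$, a switchable pair if $\theta(uv)=0$; adjacent if $\theta(uv)\in\{0,1\}$. A clique is a set of pairwise adjacent vertices; a strong clique a set of pairwise strongly adjacent vertices. The full realization of $T$ is the graph on $V(T)$ whose edges are the adjacent pairs. $T$ is a line trigraph if its full realization is the line graph of a bipartite graph and every clique of size at least $3$ in $T$ is a strong clique. A semirealization of $T$ is a trigraph $T'$ on $V(T)$ such that every strongly adjacent pair of $T$ is strongly adjacent in $T'$ and every strongly antiadjacent pair of $T$ is strongly antiadjacent in $T'$. A realization of $T$ is a semirealization with no switchable pairs, i.e. a graph. *)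

theory Defs
  imports Main "HOL-Library.Ramsey"
begin

section \<open>Finite simple graphs and line graphs of bipartite graphs\<close>

record 'a ugraph =
  gverts :: "'a set"
  gedges :: "'a set set"

definition simple_graph :: "'a ugraph \<Rightarrow> bool" where
  "simple_graph G \<longleftrightarrow> finite (gverts G) \<and> gedges G \<subseteq> nsets (gverts G) 2"

definition bipartite :: "'a ugraph \<Rightarrow> bool" where
  "bipartite G \<longleftrightarrow> (\<exists>A B. A \<union> B = gverts G \<and> A \<inter> B = {} \<and>
     (\<forall>e\<in>gedges G. \<exists>a\<in>A. \<exists>b\<in>B. e = {a, b}))"

definition line_graph :: "'a ugraph \<Rightarrow> 'a set ugraph" where
  "line_graph H = \<lparr>gverts = gedges H,
     gedges = {{e, f} | e f. e \<in> gedges H \<and> f \<in> gedges H \<and> e \<noteq> f \<and> e \<inter> f \<noteq> {}}\<rparr>"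

definition graph_iso :: "'a ugraph \<Rightarrow> 'b ugraph \<Rightarrow> bool" where
  "graph_iso G H \<longleftrightarrow> (\<exists>f. bij_betw f (gverts G) (gverts H) \<and>
     (\<forall>u\<in>gverts G. \<forall>v\<in>gverts G. {u, v} \<in> gedges G \<longleftrightarrow> {f u, f v} \<in> gedges H))"

text \<open>HOL cannot quantify over the vertex type of the bipartite graph. Since graphs are finite,
  vertices in \<open>nat\<close> lose no generality; see \<open>line_graph_of_bipartiteI\<close> below.\<close>

definition line_graph_of_bipartite :: "'a ugraph \<Rightarrow> bool" where
  "line_graph_of_bipartite G \<longleftrightarrow>
     (\<exists>H :: nat ugraph. simple_graph H \<and> bipartite H \<and> graph_iso G (line_graph H))"

lemma line_graph_of_bipartiteI:
  fixes G :: "'a ugraph" and H :: "'b ugraph"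
  assumes H: "simple_graph H" "bipartite H" and iso: "graph_iso G (line_graph H)"
  shows "line_graph_of_bipartite G"
proof -
  have fin: "finite (gverts H)" and sub: "gedges H \<subseteq> nsets (gverts H) 2"
    using H(1) by (auto simp: simple_graph_def)
  obtain g :: "'b \<Rightarrow> nat" where g: "inj_on g (gverts H)"
    using finite_imp_inj_to_nat_seg[OF fin] by blast
  have EV: "e \<subseteq> gverts H" if "e \<in> gedges H" for e
    using that sub by (auto simp: nsets_def)
  define K where "K = \<lparr>gverts = g ` gverts H, gedges = (`) g ` gedges H\<rparr>"
  have K: "gverts K = g ` gverts H" "gedges K = (`) g ` gedges H"
    by (simp_all add: K_def)
  have inj: "inj_on ((`) g) (gedges H)"
    using EV inj_on_image_eq_iff[OF g] by (auto simp: inj_on_def)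
  have "card (g ` e) = 2 \<and> finite (g ` e) \<and> g ` e \<subseteq> g ` gverts H" if "e \<in> gedges H" for e
  proof -
    have "card e = 2" "finite e" using that sub by (auto simp: nsets_def)
    then show ?thesis using card_image[OF inj_on_subset[OF g EV[OF that]]] EV[OF that] by auto
  qed
  then have 1: "simple_graph K"
    using fin by (auto simp: simple_graph_def K nsets_def)
  obtain A B where AB: "A \<union> B = gverts H" "A \<inter> B = {}"
    "\<forall>e\<in>gedges H. \<exists>a\<in>A. \<exists>b\<in>B. e = {a, b}"
    using H(2) by (auto simp: bipartite_def)
  have "g ` A \<union> g ` B = gverts K" using AB(1) by (auto simp: K)
  moreover have "g ` A \<inter> g ` B = {}"
    using inj_on_image_Int[OF g, of A B] AB by auto
  moreover have "\<forall>e\<in>gedges K. \<exists>a\<in>g ` A. \<exists>b\<in>g ` B. e = {a, b}"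
    using AB(3) by (fastforce simp: K)
  ultimately have 2: "bipartite K" unfolding bipartite_def by blast
  have LEK: "{e, f} \<in> gedges (line_graph J) \<longleftrightarrow>
      e \<in> gedges J \<and> f \<in> gedges J \<and> e \<noteq> f \<and> e \<inter> f \<noteq> {}" for J :: "nat ugraph" and e f
    by (auto simp: line_graph_def doubleton_eq_iff)
  have LEH: "{e, f} \<in> gedges (line_graph H) \<longleftrightarrow>
      e \<in> gedges H \<and> f \<in> gedges H \<and> e \<noteq> f \<and> e \<inter> f \<noteq> {}" for e f
    by (auto simp: line_graph_def doubleton_eq_iff)
  obtain h where h: "bij_betw h (gverts G) (gedges H)"
    "\<forall>u\<in>gverts G. \<forall>v\<in>gverts G. {u, v} \<in> gedges G \<longleftrightarrow> {h u, h v} \<in> gedges (line_graph H)"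
    using iso by (auto simp: graph_iso_def line_graph_def)
  have "bij_betw ((`) g \<circ> h) (gverts G) (gverts (line_graph K))"
    using bij_betw_trans[OF h(1) inj_on_imp_bij_betw[OF inj]] by (simp add: line_graph_def K)
  moreover have "{u, v} \<in> gedges G \<longleftrightarrow> {((`) g \<circ> h) u, ((`) g \<circ> h) v} \<in> gedges (line_graph K)"
    if "u \<in> gverts G" "v \<in> gverts G" for u v
  proof -
    have hu: "h u \<in> gedges H" "h v \<in> gedges H" using h(1) that by (auto dest: bij_betwE)
    then have "g ` h u \<inter> g ` h v = {} \<longleftrightarrow> h u \<inter> h v = {}"
      using inj_on_image_Int[OF g EV EV, of "h u" "h v"] by auto
    moreover have "g ` h u = g ` h v \<longleftrightarrow> h u = h v"
      using inj hu by (auto simp: inj_on_eq_iff)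
    ultimately show ?thesis using h(2) that hu by (auto simp: LEK LEH K)
  qed
  ultimately have "graph_iso G (line_graph K)" unfolding graph_iso_def by blast
  with 1 2 show ?thesis unfolding line_graph_of_bipartite_def by blast
qed


section \<open>Trigraphs\<close>

text \<open>Only the values of \<open>theta\<close> on two-element subsets of the vertex set are ever used.\<close>

record 'a trigraph =
  tverts :: "'a set"
  theta :: "'a set \<Rightarrow> int"

definition is_trigraph :: "'a trigraph \<Rightarrow> bool" where
  "is_trigraph T \<longleftrightarrow> finite (tverts T) \<and> theta T \<in> nsets (tverts T) 2 \<rightarrow> {-1, 0, 1}"

definition strongly_adjacent :: "'a trigraph \<Rightarrow> 'a \<Rightarrow> 'a \<Rightarrow> bool" where
  "strongly_adjacent T u v \<longleftrightarrow>
     u \<in> tverts T \<and> v \<in> tverts T \<and> u \<noteq> v \<and> theta T {u, v} = 1"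

definition strongly_antiadjacent :: "'a trigraph \<Rightarrow> 'a \<Rightarrow> 'a \<Rightarrow> bool" where
  "strongly_antiadjacent T u v \<longleftrightarrow>
     u \<in> tverts T \<and> v \<in> tverts T \<and> u \<noteq> v \<and> theta T {u, v} = -1"

definition switchable_pair :: "'a trigraph \<Rightarrow> 'a \<Rightarrow> 'a \<Rightarrow> bool" where
  "switchable_pair T u v \<longleftrightarrow>
     u \<in> tverts T \<and> v \<in> tverts T \<and> u \<noteq> v \<and> theta T {u, v} = 0"

definition adjacent :: "'a trigraph \<Rightarrow> 'a \<Rightarrow> 'a \<Rightarrow> bool" where
  "adjacent T u v \<longleftrightarrow>
     u \<in> tverts T \<and> v \<in> tverts T \<and> u \<noteq> v \<and> theta T {u, v} \<in> {0, 1}"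

definition clique :: "'a trigraph \<Rightarrow> 'a set \<Rightarrow> bool" where
  "clique T K \<longleftrightarrow> K \<subseteq> tverts T \<and> (\<forall>u\<in>K. \<forall>v\<in>K. u \<noteq> v \<longrightarrow> adjacent T u v)"

definition strong_clique :: "'a trigraph \<Rightarrow> 'a set \<Rightarrow> bool" where
  "strong_clique T K \<longleftrightarrow> K \<subseteq> tverts T \<and> (\<forall>u\<in>K. \<forall>v\<in>K. u \<noteq> v \<longrightarrow> strongly_adjacent T u v)"

definition full_realization :: "'a trigraph \<Rightarrow> 'a ugraph" where
  "full_realization T = \<lparr>gverts = tverts T, gedges = {{u, v} | u v. adjacent T u v}\<rparr>"

definition line_trigraph :: "'a trigraph \<Rightarrow> bool" where
  "line_trigraph T \<longleftrightarrow> is_trigraph T \<and> line_graph_of_bipartite (full_realization T) \<and>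
     (\<forall>K. clique T K \<and> card K \<ge> 3 \<longrightarrow> strong_clique T K)"

definition semirealization :: "'a trigraph \<Rightarrow> 'a trigraph \<Rightarrow> bool" where
  "semirealization T T' \<longleftrightarrow> is_trigraph T' \<and> tverts T' = tverts T \<and>
     (\<forall>u v. strongly_adjacent T u v \<longrightarrow> strongly_adjacent T' u v) \<and>
     (\<forall>u v. strongly_antiadjacent T u v \<longrightarrow> strongly_antiadjacent T' u v)"

text \<open>A trigraph \<open>R\<close> without switchable pairs is identified with the graph whose edges are its
  (strongly) adjacent pairs, that is, with \<open>full_realization R\<close>.\<close>

definition realization :: "'a trigraph \<Rightarrow> 'a trigraph \<Rightarrow> bool" where
  "realization T R \<longleftrightarrow> semirealization T R \<and> (\<forall>u v. \<not> switchable_pair R u v)"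

end

theory Submission
  imports Defs
begin

text \<open>A graph is the line graph of a bipartite graph iff its vertices carry two coordinates (the two
  ends of the corresponding edge) that jointly separate vertices, two vertices being adjacent iff
  they agree in a coordinate. If three vertices of a line trigraph agree in a coordinate, they form
  a triangle, which is a strong clique. Hence a switchable pair that becomes antiadjacent in a
  semirealization is an entire fibre of a coordinate, and splitting that fibre yields coordinates
  for the semirealization.\<close>

lemma line_graph_of_bipartite_coordinates:
  assumes "line_graph_of_bipartite G"
  obtains a b :: "'a \<Rightarrow> nat"
  where "\<And>u v. \<lbrakk>u \<in> gverts G; v \<in> gverts G; a u = a v; b u = b v\<rbrakk> \<Longrightarrow> u = v"
    and "\<And>u v. \<lbrakk>u \<in> gverts G; v \<in> gverts G\<rbrakk> \<Longrightarrow>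
      {u, v} \<in> gedges G \<longleftrightarrow> u \<noteq> v \<and> (a u = a v \<or> b u = b v)"
proof -
  obtain H :: "nat ugraph" where H: "bipartite H" "graph_iso G (line_graph H)"
    using assms by (auto simp: line_graph_of_bipartite_def)
  obtain A B where AB: "A \<inter> B = {}" "\<forall>e\<in>gedges H. \<exists>a\<in>A. \<exists>b\<in>B. e = {a, b}"
    using H(1) by (auto simp: bipartite_def)
  obtain f where f: "bij_betw f (gverts G) (gedges H)"
    "\<forall>u\<in>gverts G. \<forall>v\<in>gverts G. {u, v} \<in> gedges G \<longleftrightarrow> {f u, f v} \<in> gedges (line_graph H)"
    using H(2) by (auto simp: graph_iso_def line_graph_def)
  have fE: "f u \<in> gedges H" if "u \<in> gverts G" for u
    using f(1) that by (auto dest: bij_betwE)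
  then have "\<forall>u\<in>gverts G. \<exists>x y. x \<in> A \<and> y \<in> B \<and> f u = {x, y}"
    using AB(2) by blast
  then obtain a b where ab: "a u \<in> A" "b u \<in> B" "f u = {a u, b u}" if "u \<in> gverts G" for u
    by metis
  have finj: "f u = f v \<longleftrightarrow> u = v" if "u \<in> gverts G" "v \<in> gverts G" for u v
    using f(1) that by (auto simp: bij_betw_def inj_on_eq_iff)
  show thesis
  proof (rule that[of a b])
    fix u v assume uv: "u \<in> gverts G" "v \<in> gverts G"
    show "u = v" if "a u = a v" "b u = b v"
      using that ab(3) uv finj by metis
    \<comment> \<open>Because \<open>A\<close> and \<open>B\<close> are disjoint, the
      \<open>A\<close>-end of one edge can never be the \<open>B\<close>-end of the other, so two
      edges can meet only on a common side.\<close>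
    have "f u \<inter> f v \<noteq> {} \<longleftrightarrow> a u = a v \<or> b u = b v"
      using ab[OF uv(1)] ab[OF uv(2)] AB(1) by auto
    moreover have "{f u, f v} \<in> gedges (line_graph H) \<longleftrightarrow> f u \<noteq> f v \<and> f u \<inter> f v \<noteq> {}"
      using fE uv by (auto simp: line_graph_def doubleton_eq_iff)
    ultimately show "{u, v} \<in> gedges G \<longleftrightarrow> u \<noteq> v \<and> (a u = a v \<or> b u = b v)"
      using f(2) uv finj by blast
  qed
qed

text \<open>Each vertex becomes the edge joining its two coordinate values. The tags
  \<open>Inl\<close> and \<open>Inr\<close> keep the two sides disjoint even if the coordinates
  share values. The coordinate types are left arbitrary because the lemma is later applied to
  set-valued coordinates.\<close>

lemma coordinates_line_graph_of_bipartite: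
  fixes a :: "'a \<Rightarrow> 'b" and b :: "'a \<Rightarrow> 'c"
  assumes fin: "finite (gverts G)"
    and inj: "\<And>u v. \<lbrakk>u \<in> gverts G; v \<in> gverts G; a u = a v; b u = b v\<rbrakk> \<Longrightarrow> u = v"
    and adj: "\<And>u v. \<lbrakk>u \<in> gverts G; v \<in> gverts G\<rbrakk> \<Longrightarrow>
      {u, v} \<in> gedges G \<longleftrightarrow> u \<noteq> v \<and> (a u = a v \<or> b u = b v)"
  shows "line_graph_of_bipartite G"
proof -
  define f where "f u = {Inl (a u), Inr (b u)}" for u
  define H where "H = \<lparr>gverts = Inl ` a ` gverts G \<union> Inr ` b ` gverts G, gedges = f ` gverts G\<rparr>"
  have "simple_graph H"
    using fin by (auto simp: simple_graph_def H_def nsets_def f_def)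
  moreover have "bipartite H"
    unfolding bipartite_def H_def f_def
    by (rule exI[of _ "Inl ` a ` gverts G"], rule exI[of _ "Inr ` b ` gverts G"]) auto
  moreover have "graph_iso G (line_graph H)"
    unfolding graph_iso_def
  proof (intro exI[of _ f] conjI ballI)
    have finj: "inj_on f (gverts G)"
      using inj by (auto simp: inj_on_def f_def doubleton_eq_iff)
    then show "bij_betw f (gverts G) (gverts (line_graph H))"
      by (simp add: bij_betw_def line_graph_def H_def)
    fix u v assume uv: "u \<in> gverts G" "v \<in> gverts G"
    have "{f u, f v} \<in> gedges (line_graph H) \<longleftrightarrow> f u \<noteq> f v \<and> f u \<inter> f v \<noteq> {}"
      using uv by (auto simp: line_graph_def H_def doubleton_eq_iff)
    moreover have "f u \<inter> f v \<noteq> {} \<longleftrightarrow> a u = a v \<or> b u = b v"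
      by (auto simp: f_def)
    ultimately show "{u, v} \<in> gedges G \<longleftrightarrow> {f u, f v} \<in> gedges (line_graph H)"
      using adj[OF uv] finj uv by (auto simp: inj_on_eq_iff)
  qed
  ultimately show ?thesis by (rule line_graph_of_bipartiteI)
qed

lemma adjacent_sym: "adjacent T u v \<longleftrightarrow> adjacent T v u"
  by (auto simp: adjacent_def insert_commute)

lemma edge_full_realization: "{u, v} \<in> gedges (full_realization T) \<longleftrightarrow> adjacent T u v"
  using adjacent_sym[of T] by (auto simp: full_realization_def doubleton_eq_iff)

text \<open>Strong antiadjacency passes from \<open>T\<close> to \<open>T'\<close>, so a pair
  adjacent in \<open>T'\<close> cannot have value -1 in \<open>T\<close>.\<close>

lemma semirealization_adjacentD:
  assumes "is_trigraph T" "semirealization T T'" "adjacent T' u v"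
  shows "adjacent T u v"
proof -
  have uv: "u \<in> tverts T" "v \<in> tverts T" "u \<noteq> v" "theta T' {u, v} \<noteq> -1"
    using assms(2,3) by (auto simp: semirealization_def adjacent_def)
  then have "theta T {u, v} \<in> {-1, 0, 1}"
    using assms(1) by (auto simp: is_trigraph_def nsets_def Pi_iff)
  moreover have "theta T {u, v} \<noteq> -1"
    using assms(2) uv by (auto simp: semirealization_def strongly_antiadjacent_def)
  ultimately show ?thesis using uv by (auto simp: adjacent_def)
qed

lemma line_trigraph_triangle:
  assumes "line_trigraph T" "adjacent T u v" "adjacent T v w" "adjacent T u w"
  shows "strongly_adjacent T u v"
proof -
  have ne: "u \<noteq> v" "v \<noteq> w" "u \<noteq> w"
    using assms(2-4) by (auto simp: adjacent_def)
  have "clique T {u, v, w}"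
    using assms(2-4) adjacent_sym[of T] unfolding clique_def by (auto simp: adjacent_def)
  moreover have "card {u, v, w} \<ge> 3" using ne by simp
  ultimately have "strong_clique T {u, v, w}"
    using assms(1) by (auto simp: line_trigraph_def)
  then show ?thesis using ne by (auto simp: strong_clique_def)
qed

lemma full_realization_semirealization:
  assumes T: "line_trigraph T" and T': "semirealization T T'"
  shows "line_graph_of_bipartite (full_realization T')"
proof -
  let ?V = "tverts T"
  have V: "gverts (full_realization T) = ?V" "gverts (full_realization T') = ?V" "tverts T' = ?V"
    using T' by (auto simp: full_realization_def semirealization_def)
  obtain a b :: "'a \<Rightarrow> nat"
    where inj: "\<And>u v. \<lbrakk>u \<in> ?V; v \<in> ?V; a u = a v; b u = b v\<rbrakk> \<Longrightarrow> u = v"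
      and adj: "\<And>u v. \<lbrakk>u \<in> ?V; v \<in> ?V\<rbrakk> \<Longrightarrow>
        adjacent T u v \<longleftrightarrow> u \<noteq> v \<and> (a u = a v \<or> b u = b v)"
    using line_graph_of_bipartite_coordinates[of "full_realization T"] T
    unfolding line_trigraph_def edge_full_realization V by blast
  \<comment> \<open>The piece of the \<open>c\<close>-fibre of \<open>u\<close> formed by
    \<open>u\<close> and its \<open>T'\<close>-neighbours serves itself as the new coordinate value.
    A fibre with at least three vertices stays whole; a fibre of two vertices falls into singletons
    exactly when they are antiadjacent in \<open>T'\<close>.\<close>
  define split where
    "split c u = {w \<in> ?V. c w = c u \<and> (w = u \<or> adjacent T' u w)}" for c :: "'a \<Rightarrow> nat" and u
  \<comment> \<open>Stated for any \<open>c\<close> whose fibres are cliques of \<open>T\<close>, so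
    that it covers both \<open>a\<close> and \<open>b\<close>.\<close>
  have split: "split c u = split c v \<longleftrightarrow> c u = c v \<and> (u = v \<or> adjacent T' u v)"
    if c: "\<And>x y. \<lbrakk>x \<in> ?V; y \<in> ?V; x \<noteq> y; c x = c y\<rbrakk> \<Longrightarrow> adjacent T x y"
      and uv: "u \<in> ?V" "v \<in> ?V" for c u v
  proof
    assume "split c u = split c v"
    moreover have "v \<in> split c v" using uv by (simp add: split_def)
    ultimately have "v \<in> split c u" by simp
    then show "c u = c v \<and> (u = v \<or> adjacent T' u v)" by (auto simp: split_def)
  next
    assume R: "c u = c v \<and> (u = v \<or> adjacent T' u v)"
    \<comment> \<open>The third vertex \<open>z\<close> of the fibre completes a triangle in
      \<open>T\<close>, which makes \<open>x\<close> and \<open>y\<close> strongly adjacent in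
      \<open>T\<close> and hence in \<open>T'\<close>.\<close>
    have tri: "adjacent T' x y"
      if "x \<in> ?V" "y \<in> ?V" "z \<in> ?V" "c x = c y" "c y = c z" "x \<noteq> y" "y \<noteq> z" "x \<noteq> z" for x y z
    proof -
      have "strongly_adjacent T x y"
        using line_trigraph_triangle[OF T] c that by metis
      then have "strongly_adjacent T' x y" using T' by (simp add: semirealization_def)
      then show ?thesis by (simp add: strongly_adjacent_def adjacent_def)
    qed
    \<comment> \<open>If \<open>u\<close>, \<open>v\<close>, \<open>w\<close> are distinct,
      \<open>tri\<close> makes both sides true; otherwise the claim follows from \<open>R\<close>
      and symmetry.\<close>
    have "w = u \<or> adjacent T' u w \<longleftrightarrow> w = v \<or> adjacent T' v w" if "w \<in> ?V" "c w = c u" for w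
      using tri[of u w v] tri[of v w u] R that uv adjacent_sym[of T'] by metis
    then show "split c u = split c v" using R by (auto simp: split_def)
  qed
  have sa: "split a u = split a v \<longleftrightarrow> a u = a v \<and> (u = v \<or> adjacent T' u v)"
    and sb: "split b u = split b v \<longleftrightarrow> b u = b v \<and> (u = v \<or> adjacent T' u v)"
    if "u \<in> ?V" "v \<in> ?V" for u v
    by (rule split; use that adj in simp)+
  show ?thesis
  proof (rule coordinates_line_graph_of_bipartite[of _ "split a" "split b"],
      unfold V edge_full_realization)
    show "finite ?V" using T by (auto simp: line_trigraph_def is_trigraph_def)
    fix u v assume uv: "u \<in> ?V" "v \<in> ?V"
    \<comment> \<open>The new coordinates refine the old ones, so they still separate
      vertices.\<close>
    show "u = v" if "split a u = split a v" "split b u = split b v"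
      using that inj uv sa sb by blast
    \<comment> \<open>A pair adjacent in \<open>T'\<close> thus shares an old coordinate, and by
      \<open>sa\<close> or \<open>sb\<close> its two vertices lie in the same piece.\<close>
    have "adjacent T' u v \<Longrightarrow> adjacent T u v"
      using semirealization_adjacentD[OF _ T'] T by (simp add: line_trigraph_def)
    then show "adjacent T' u v \<longleftrightarrow> u \<noteq> v \<and> (split a u = split a v \<or> split b u = split b v)"
      using sa[OF uv] sb[OF uv] adj[OF uv] by blast
  qed
qed

theorem theorem2p1:
  fixes T :: "'a trigraph"
  assumes "line_trigraph T"
  shows "(\<forall>R. realization T R \<longrightarrow> line_graph_of_bipartite (full_realization R)) \<and>
         (\<forall>T'. semirealization T T' \<longrightarrow> line_trigraph T')"
proof (intro conjI allI impI)
  show "line_graph_of_bipartite (full_realization R)" if "realization T R" for R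
    using full_realization_semirealization assms that by (auto simp: realization_def)
next
  fix T' assume T': "semirealization T T'"
  have "strong_clique T' K" if K: "clique T' K" "card K \<ge> 3" for K
  proof -
    \<comment> \<open>Cliques pass back from \<open>T'\<close> to \<open>T\<close>, where they are
      strong by hypothesis, and strong cliques pass forward to \<open>T'\<close>.\<close>
    have "clique T K"
      using K(1) T' assms semirealization_adjacentD[of T T']
      by (auto simp: clique_def semirealization_def line_trigraph_def)
    then have "strong_clique T K" using assms K(2) by (auto simp: line_trigraph_def)
    then show ?thesis using T' by (auto simp: strong_clique_def semirealization_def)
  qed
  moreover have "is_trigraph T'" using T' by (simp add: semirealization_def)
  ultimately show "line_trigraph T'"
    using full_realization_semirealization[OF assms T'] by (auto simp: line_trigraph_def)
qed

end
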